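(* Let $k$ be an even integer and $t$ an odd integer with $0<t<k$. Let $\mathcal{H}$ be a $k$-uniform hypergraph with $n$ vertices and $m\geq 1$ edges, let $\delta$ be the minimum degree of $\mathcal{H}$, and let $\lambda$ be the minimum $H$-eigenvalue of $\mathcal{H}$. Then \[ \alpha_t(\mathcal{H}) \leq \frac{t\,(km-n\lambda)\,(-\lambda)^{\frac{t}{k-t}}}{(k-t)\,\delta^{\frac{k}{k-t}}+(k\delta-t\lambda)\,(-\lambda)^{\frac{t}{k-t}}}, \] with equality if and only if there exists a $t$-independent set $S$ of $\mathcal{H}$ such that every vertex in $S$ has degree $\delta$, and every vertex $i\notin S$ satisfies \[ \left|\{e: e\in E(i),\ e\cap S\neq\emptyset\}\right| = \frac{(-\lambda)^{\frac{k}{k-t}}+d_i(-\lambda)^{\frac{t}{k-t}}}{\delta^{\frac{t}{k-t}}+(-\lambda)^{\frac{t}{k-t}}}. \]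
   Context: A hypergraph $\mathcal{H}$ is $k$-uniform if every edge consists of exactly $k$ distinct vertices; $V(\mathcal{H})$, $E(\mathcal{H})$ denote its vertex and edge sets. For a vertex $i$, $E(i)$ is the set of edges containing $i$ and $d_i=|E(i)|$ is its degree. For $0<t<k$, a set $S\subseteq V(\mathcal{H})$ is a $t$-independent set if $|e\cap S|\in\{0,t\}$ for every edge $e$; $\alpha_t(\mathcal{H})$ is the maximum size of a $t$-independent set. The adjacency tensor $\mathcal{A}_{\mathcal{H}}=(a_{i_1\cdots i_k})$ is the order-$k$, dimension-$n$ tensor with $a_{i_1\cdots i_k}=\frac{1}{(k-1)!}$ if $\{i_1,\dots,i_k\}\in E(\mathcal{H})$ and $0$ otherwise. For a tensor $\mathcal{A}$ and $x\in\mathbb{C}^n$, $(\mathcal{A}x^{k-1})_i=\sum_{i_2,\dots,i_k}a_{i i_2\cdots i_k}x_{i_2}\cdots x_{i_k}$; $\lambda$ is an eigenvalue with eigenvector $x\neq 0$ if $\mathcal{A}x^{k-1}=\lambda x^{[k-1]}$ where $x^{[k-1]}=(x_1^{k-1},\dots,x_n^{k-1})^\top$; it is an $H$-eigenvalue if $\lambda$ is real with a real eigenvector. The minimum $H$-eigenvalue of $\mathcal{A}_{\mathcal{H}}$ is called the minimum $H$-eigenvalue of $\mathcal{H}$. *)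

theory Defs
  imports Complex_Main
begin

definition hypergraph :: "'a set \<Rightarrow> 'a set set \<Rightarrow> bool" where
  "hypergraph V E \<longleftrightarrow> finite V \<and> E \<subseteq> Pow V"

definition uniform_hypergraph :: "nat \<Rightarrow> 'a set \<Rightarrow> 'a set set \<Rightarrow> bool" where
  "uniform_hypergraph k V E \<longleftrightarrow> hypergraph V E \<and> (\<forall>e\<in>E. card e = k)"

definition edges_at :: "'a set set \<Rightarrow> 'a \<Rightarrow> 'a set set" where
  "edges_at E i = {e \<in> E. i \<in> e}"

definition degree :: "'a set set \<Rightarrow> 'a \<Rightarrow> nat" where
  "degree E i = card (edges_at E i)"

definition min_degree :: "'a set \<Rightarrow> 'a set set \<Rightarrow> nat" where
  "min_degree V E = Min (degree E ` V)"

definition t_independent :: "nat \<Rightarrow> 'a set \<Rightarrow> 'a set set \<Rightarrow> 'a set \<Rightarrow> bool" where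
  "t_independent t V E S \<longleftrightarrow> S \<subseteq> V \<and> (\<forall>e\<in>E. card (e \<inter> S) \<in> {0, t})"

definition t_independence_number :: "nat \<Rightarrow> 'a set \<Rightarrow> 'a set set \<Rightarrow> nat" where
  "t_independence_number t V E = Max (card ` {S. t_independent t V E S})"

text \<open>
  A tensor of order \<open>k\<close> whose indices range over the finite set \<open>V\<close> is a function
  on index lists \<open>[i\<^sub>1, \<dots>, i\<^sub>k]\<close>; only its values on lists of length \<open>k\<close> over \<open>V\<close>
  are used.  A vector is a function on indices, of which only the restriction to \<open>V\<close>
  is used.
\<close>

type_synonym 'a tensor = "'a list \<Rightarrow> complex"

definition tensor_apply ::
  "'a set \<Rightarrow> nat \<Rightarrow> 'a tensor \<Rightarrow> ('a \<Rightarrow> complex) \<Rightarrow> 'a \<Rightarrow> complex" where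
  "tensor_apply V k A x i =
     (\<Sum>js | length js = k - 1 \<and> set js \<subseteq> V. A (i # js) * prod_list (map x js))"

definition tensor_eigenpair ::
  "'a set \<Rightarrow> nat \<Rightarrow> 'a tensor \<Rightarrow> complex \<Rightarrow> ('a \<Rightarrow> complex) \<Rightarrow> bool" where
  "tensor_eigenpair V k A lam x \<longleftrightarrow>
     (\<exists>i\<in>V. x i \<noteq> 0) \<and> (\<forall>i\<in>V. tensor_apply V k A x i = lam * x i ^ (k - 1))"

definition H_eigenvalue :: "'a set \<Rightarrow> nat \<Rightarrow> 'a tensor \<Rightarrow> real \<Rightarrow> bool" where
  "H_eigenvalue V k A lam \<longleftrightarrow>
     (\<exists>x. (\<forall>i\<in>V. x i \<in> \<real>) \<and> tensor_eigenpair V k A (complex_of_real lam) x)"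

definition min_H_eigenvalue :: "'a set \<Rightarrow> nat \<Rightarrow> 'a tensor \<Rightarrow> real" where
  "min_H_eigenvalue V k A = (LEAST lam. H_eigenvalue V k A lam)"

text \<open>
  When all edges have \<open>k\<close> elements, an index list of length \<open>k\<close> whose set of entries is
  an edge is automatically free of repetitions.
\<close>

definition adjacency_tensor :: "nat \<Rightarrow> 'a set set \<Rightarrow> 'a tensor" where
  "adjacency_tensor k E js = (if set js \<in> E then 1 / fact (k - 1) else 0)"

definition hypergraph_min_H_eigenvalue :: "nat \<Rightarrow> 'a set \<Rightarrow> 'a set set \<Rightarrow> real" where
  "hypergraph_min_H_eigenvalue k V E = min_H_eigenvalue V k (adjacency_tensor k E)"

end

(*
  For even k the least H-eigenvalue lam is the minimum of A x^k over the real sphere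
  {sum of x_i^k = 1}, which exists by compactness: a minimiser is stationary, hence an
  eigenvector.  So the form gap(x) = A x^k - lam * (sum of x_i^k) is nonnegative, and it
  vanishes exactly at the eigenvectors of lam and at 0.

  For a t-independent set S, take x = -s on S and x = 1 elsewhere, with
  s^(k-t) = delta / (-lam).  With W = (-lam)^(t/(k-t)) and D the denominator of the bound,

    (bound - |S|) * D = t * W * gap(x) + k * (1 + s^t) * W * (sum over i in S of (d_i - delta)).

  Both terms on the right are nonnegative.  Equality holds iff all degrees in S are delta and
  x satisfies the eigenvector equations; those at S hold by the choice of s, and those outside S
  are the stated edge counts.  When delta = 0, s = 0 and nothing changes.
*)
theory Submission
  imports
    Defs
    "HOL-Analysis.Function_Topology"
    "HOL-Combinatorics.Multiset_Permutations"
begin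

section \<open>Polynomial forms of a hypergraph\<close>

text \<open>Each edge arises from k! index tuples of weight 1/(k-1)!, so A x^k is \<open>k\<close>
  times this form.\<close>

definition edge_form :: "'a set set \<Rightarrow> ('a \<Rightarrow> 'b::comm_semiring_1) \<Rightarrow> 'b" where
  "edge_form E x = (\<Sum>e\<in>E. \<Prod>j\<in>e. x j)"

text \<open>The partial derivative of \<open>edge_form\<close> in coordinate \<open>i\<close>, and
  by \<open>tensor_apply_adjacency\<close> the \<open>i\<close>-th coordinate of A x^(k-1). The
  value type stays open because eigenvectors are complex by definition but real in the
  argument.\<close>

definition link_form :: "'a set set \<Rightarrow> ('a \<Rightarrow> 'b::comm_semiring_1) \<Rightarrow> 'a \<Rightarrow> 'b" where
  "link_form E x i = (\<Sum>e\<in>edges_at E i. \<Prod>j\<in>e - {i}. x j)"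

text \<open>The Rayleigh quotient condition with its denominator cleared, so that minimality can be
  studied over all vectors, without a constraint.\<close>

definition rayleigh_gap :: "nat \<Rightarrow> 'a set \<Rightarrow> 'a set set \<Rightarrow> real \<Rightarrow> ('a \<Rightarrow> real) \<Rightarrow> real" where
  "rayleigh_gap k V E lam x = real k * edge_form E x - lam * (\<Sum>i\<in>V. x i ^ k)"

section \<open>Incidence counting and Euler's identity\<close>

context
  fixes k :: nat and V :: "'a set" and E :: "'a set set"
  assumes uniform: "uniform_hypergraph k V E"
begin

lemma finite_vertices: "finite V"
  and edge_subset: "e \<in> E \<Longrightarrow> e \<subseteq> V"
  and card_edge: "e \<in> E \<Longrightarrow> card e = k"
  using uniform by (auto simp: uniform_hypergraph_def hypergraph_def)

lemma finite_edges: "finite E"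
  using uniform finite_vertices
  by (metis finite_Pow_iff hypergraph_def rev_finite_subset uniform_hypergraph_def)

lemma finite_edge: "e \<in> E \<Longrightarrow> finite e"
  using edge_subset finite_vertices finite_subset by blast

text \<open>Double counting of incident pairs. It serves Euler's identity with \<open>S = V\<close>
  and the degree sum of a t-independent set with \<open>f = 1\<close>.\<close>

lemma sum_edges_at:
  fixes f :: "'a set \<Rightarrow> 'b::comm_semiring_1"
  assumes "S \<subseteq> V"
  shows "(\<Sum>i\<in>S. \<Sum>e\<in>edges_at E i. f e) = (\<Sum>e\<in>E. of_nat (card (e \<inter> S)) * f e)"
proof -
  have "finite S" using assms finite_vertices finite_subset by blast
  have "(\<Sum>i\<in>S. \<Sum>e\<in>edges_at E i. f e) = (\<Sum>e\<in>E. \<Sum>i | i \<in> S \<and> i \<in> e. f e)"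
    unfolding edges_at_def by (rule sum.swap_restrict[OF \<open>finite S\<close> finite_edges])
  also have "\<dots> = (\<Sum>e\<in>E. of_nat (card (e \<inter> S)) * f e)"
    by (intro sum.cong refl) (simp add: Int_def conj_commute)
  finally show ?thesis .
qed

text \<open>Euler's identity for a form of degree \<open>k\<close>: every edge is counted once at
  each of its \<open>k\<close> vertices.\<close>

lemma link_form_euler:
  fixes x :: "'a \<Rightarrow> 'b::comm_semiring_1"
  shows "(\<Sum>i\<in>V. x i * link_form E x i) = of_nat k * edge_form E x"
proof -
  have "x i * link_form E x i = (\<Sum>e\<in>edges_at E i. \<Prod>j\<in>e. x j)" for i
    unfolding link_form_def sum_distrib_left
    by (intro sum.cong refl prod.remove[symmetric]) (auto simp: edges_at_def finite_edge)
  then have "(\<Sum>i\<in>V. x i * link_form E x i) = (\<Sum>e\<in>E. of_nat (card (e \<inter> V)) * (\<Prod>j\<in>e. x j))"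
    by (simp add: sum_edges_at)
  also have "\<dots> = (\<Sum>e\<in>E. of_nat k * (\<Prod>j\<in>e. x j))"
    by (intro sum.cong refl) (metis Int_absorb2 card_edge edge_subset)
  finally show ?thesis
    by (simp add: edge_form_def sum_distrib_left)
qed

section \<open>The adjacency tensor and real eigenvectors\<close>

text \<open>An edge \<open>e\<close> through \<open>i\<close> is produced by exactly the (k-1)!
  orderings of \<open>e - {i}\<close>, which cancels the weight 1/(k-1)!.\<close>

lemma tensor_apply_adjacency:
  assumes k: "0 < k"
  shows "tensor_apply V k (adjacency_tensor k E) x i = link_form E x i"
proof -
  let ?L = "{js. length js = k - 1 \<and> set js \<subseteq> V}"
  have perm: "{js \<in> ?L. insert i (set js) = e} = permutations_of_set (e - {i})"
    if e: "e \<in> edges_at E i" for e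
  proof -
    have e': "e \<in> E" "i \<in> e" "card (e - {i}) = k - 1" "finite e" "e \<subseteq> V"
      using e card_edge finite_edge edge_subset by (auto simp: edges_at_def)
    show ?thesis
    proof (intro set_eqI iffI)
      fix js assume js: "js \<in> {js \<in> ?L. insert i (set js) = e}"
      \<comment> \<open>A list of length \<open>k - 1\<close> that covers the \<open>k - 1\<close>
        vertices of \<open>e - {i}\<close> has no room for a repetition or for
        \<open>i\<close>.\<close>
      then have sub: "e - {i} \<subseteq> set js" and len: "length js = k - 1" by auto
      then have "card (set js) = length js"
        using e'(3) card_mono[OF _ sub] card_length[of js] by simp
      then have "distinct js" by (rule card_distinct)
      moreover have "set js = e - {i}"
        using sub \<open>card (set js) = length js\<close> len e'(3) by (intro sym[OF card_subset_eq]) auto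
      ultimately show "js \<in> permutations_of_set (e - {i})"
        by (simp add: permutations_of_set_def)
    next
      fix js assume "js \<in> permutations_of_set (e - {i})"
      then show "js \<in> {js \<in> ?L. insert i (set js) = e}"
        using e' distinct_card[of js] by (auto simp: permutations_of_set_def)
    qed
  qed
  have fin: "finite ?L"
    using finite_lists_length_eq[OF finite_vertices, of "k - 1"] by (simp add: conj_commute)
  \<comment> \<open>Each tensor entry becomes a sum over at most one edge, so that the double sum
    can be swapped and grouped by edges.\<close>
  have "tensor_apply V k (adjacency_tensor k E) x i
      = (\<Sum>js\<in>?L. \<Sum>e | e \<in> edges_at E i \<and> insert i (set js) = e. prod_list (map x js) / fact (k - 1))"
    unfolding tensor_apply_def
  proof (intro sum.cong refl)
    fix js
    have "{e. e \<in> edges_at E i \<and> insert i (set js) = e}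
        = (if insert i (set js) \<in> E then {insert i (set js)} else {})"
      by (auto simp: edges_at_def)
    then show "adjacency_tensor k E (i # js) * prod_list (map x js)
        = (\<Sum>e | e \<in> edges_at E i \<and> insert i (set js) = e. prod_list (map x js) / fact (k - 1))"
      by (simp add: adjacency_tensor_def)
  qed
  also have "\<dots> = (\<Sum>e\<in>edges_at E i. \<Sum>js | js \<in> ?L \<and> insert i (set js) = e. prod_list (map x js) / fact (k - 1))"
    by (rule sum.swap_restrict[OF fin]) (simp add: edges_at_def finite_edges)
  also have "\<dots> = (\<Sum>e\<in>edges_at E i. \<Prod>j\<in>e - {i}. x j)"
  proof (intro sum.cong refl)
    fix e assume e: "e \<in> edges_at E i"
    then have ce: "card (e - {i}) = k - 1" "finite (e - {i})"
      using card_edge finite_edge by (auto simp: edges_at_def)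
    have "(\<Sum>js | js \<in> ?L \<and> insert i (set js) = e. prod_list (map x js) / fact (k - 1))
        = (\<Sum>js\<in>permutations_of_set (e - {i}). (\<Prod>j\<in>e - {i}. x j) / fact (k - 1))"
      unfolding perm[OF e]
      by (intro sum.cong refl) (auto simp: permutations_of_set_def prod.distinct_set_conv_list[symmetric])
    also have "\<dots> = (\<Prod>j\<in>e - {i}. x j)"
      using ce by simp
    finally show "(\<Sum>js | js \<in> ?L \<and> insert i (set js) = e. prod_list (map x js) / fact (k - 1))
        = (\<Prod>j\<in>e - {i}. x j)" .
  qed
  finally show ?thesis by (simp add: link_form_def)
qed

lemma H_eigenvalue_iff:
  assumes k: "0 < k"
  shows "H_eigenvalue V k (adjacency_tensor k E) lam \<longleftrightarrow>
    (\<exists>y. (\<exists>i\<in>V. y i \<noteq> 0) \<and> (\<forall>i\<in>V. link_form E y i = lam * y i ^ (k - 1)))"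
proof
  assume "H_eigenvalue V k (adjacency_tensor k E) lam"
  then obtain x where real: "\<forall>i\<in>V. x i \<in> \<real>"
    and eig: "tensor_eigenpair V k (adjacency_tensor k E) (complex_of_real lam) x"
    by (auto simp: H_eigenvalue_def)
  \<comment> \<open>Off \<open>V\<close> the values of \<open>x\<close> may be non-real; taking real
    parts alters only those, and no edge sees them.\<close>
  define y where "y i = Re (x i)" for i
  have x: "x i = of_real (y i)" if "i \<in> V" for i
    using real that by (simp add: y_def)
  have "link_form E x i = of_real (link_form E y i)" for i
    unfolding link_form_def of_real_sum of_real_prod
    by (intro sum.cong prod.cong refl x) (use edge_subset in \<open>auto simp: edges_at_def\<close>)
  then have "complex_of_real (link_form E y i) = complex_of_real (lam * y i ^ (k - 1))" if "i \<in> V" for i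
    using eig that by (simp add: tensor_eigenpair_def tensor_apply_adjacency[OF k] x)
  moreover have "\<exists>i\<in>V. y i \<noteq> 0"
    using eig by (auto simp: tensor_eigenpair_def x)
  ultimately show "\<exists>y. (\<exists>i\<in>V. y i \<noteq> 0) \<and> (\<forall>i\<in>V. link_form E y i = lam * y i ^ (k - 1))"
    unfolding of_real_eq_iff by blast
next
  assume "\<exists>y. (\<exists>i\<in>V. y i \<noteq> 0) \<and> (\<forall>i\<in>V. link_form E y i = lam * y i ^ (k - 1))"
  then obtain y where y: "\<exists>i\<in>V. y i \<noteq> 0" "\<forall>i\<in>V. link_form E y i = lam * y i ^ (k - 1)"
    by blast
  have "link_form E (\<lambda>i. complex_of_real (y i)) i = of_real (link_form E y i)" for i
    by (simp add: link_form_def)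
  then show "H_eigenvalue V k (adjacency_tensor k E) lam"
    unfolding H_eigenvalue_def tensor_eigenpair_def tensor_apply_adjacency[OF k]
    by (intro exI[of _ "\<lambda>i. complex_of_real (y i)"]) (use y in auto)
qed

section \<open>Variational description of the least H-eigenvalue\<close>

text \<open>The gap is a combination of the residuals of the eigenvector equations, hence zero at
  every eigenvector for \<open>lam\<close>.\<close>

lemma rayleigh_gap_euler:
  assumes "0 < k"
  shows "rayleigh_gap k V E lam x = (\<Sum>i\<in>V. x i * (link_form E x i - lam * x i ^ (k - 1)))"
proof -
  have "x i * x i ^ (k - 1) = x i ^ k" for i
    using assms by (metis power_minus_mult mult.commute)
  then have "x i * (link_form E x i - lam * x i ^ (k - 1)) = x i * link_form E x i - lam * x i ^ k" for i
    by (simp add: algebra_simps flip: mult.left_commute)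
  then show ?thesis
    by (simp add: rayleigh_gap_def sum_subtractf link_form_euler sum_distrib_left)
qed

text \<open>Edges are sets, so the form is affine in each single coordinate, with slope
  \<open>link_form\<close>.\<close>

lemma edge_form_fun_upd:
  fixes x :: "'a \<Rightarrow> 'b::comm_semiring_1"
  shows "edge_form E (x(i := y)) = y * link_form E x i + (\<Sum>e | e \<in> E \<and> i \<notin> e. \<Prod>j\<in>e. x j)"
proof -
  have "E = edges_at E i \<union> {e \<in> E. i \<notin> e}"
    by (auto simp: edges_at_def)
  then have "edge_form E (x(i := y)) = (\<Sum>e\<in>edges_at E i \<union> {e \<in> E. i \<notin> e}. \<Prod>j\<in>e. (x(i := y)) j)"
    by (simp add: edge_form_def)
  also have "\<dots> = (\<Sum>e\<in>edges_at E i. \<Prod>j\<in>e. (x(i := y)) j) + (\<Sum>e | e \<in> E \<and> i \<notin> e. \<Prod>j\<in>e. (x(i := y)) j)"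
    by (rule sum.union_disjoint) (use finite_edges in \<open>auto simp: edges_at_def\<close>)
  also have "(\<Sum>e | e \<in> E \<and> i \<notin> e. \<Prod>j\<in>e. (x(i := y)) j) = (\<Sum>e | e \<in> E \<and> i \<notin> e. \<Prod>j\<in>e. x j)"
    by (intro sum.cong prod.cong) auto
  also have "(\<Sum>e\<in>edges_at E i. \<Prod>j\<in>e. (x(i := y)) j) = y * link_form E x i"
    unfolding link_form_def sum_distrib_left
  proof (intro sum.cong refl)
    fix e assume "e \<in> edges_at E i"
    then have "finite e" "i \<in> e" by (auto simp: edges_at_def finite_edge)
    then have "(\<Prod>j\<in>e. (x(i := y)) j) = y * (\<Prod>j\<in>e - {i}. (x(i := y)) j)"
      by (simp add: prod.remove)
    also have "(\<Prod>j\<in>e - {i}. (x(i := y)) j) = (\<Prod>j\<in>e - {i}. x j)"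
      by (intro prod.cong) auto
    finally show "(\<Prod>j\<in>e. (x(i := y)) j) = y * (\<Prod>j\<in>e - {i}. x j)" .
  qed
  finally show ?thesis .
qed

text \<open>A zero of a nonnegative gap is an unconstrained global minimum, so each partial
  derivative vanishes there and no Lagrange multiplier is involved.\<close>

lemma rayleigh_gap_minimizer_stationary:
  assumes k: "0 < k"
    and nonneg: "\<And>z. 0 \<le> rayleigh_gap k V E lam z"
    and zero: "rayleigh_gap k V E lam x = 0"
    and i: "i \<in> V"
  shows "link_form E x i = lam * x i ^ (k - 1)"
proof -
  define R where "R = (\<Sum>e | e \<in> E \<and> i \<notin> e. \<Prod>j\<in>e. x j)"
  define P where "P = (\<Sum>j\<in>V - {i}. x j ^ k)"
  define g where "g y = rayleigh_gap k V E lam (x(i := y))" for y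
  have "(\<Sum>j\<in>V. (x(i := y)) j ^ k) = y ^ k + P" for y
    using finite_vertices i by (simp add: sum.remove[of V i] P_def)
  then have g: "g = (\<lambda>y. real k * (y * link_form E x i + R) - lam * (y ^ k + P))"
    by (simp add: g_def rayleigh_gap_def edge_form_fun_upd R_def fun_eq_iff)
  have "(g has_field_derivative real k * link_form E x i - lam * (real k * x i ^ (k - 1))) (at (x i))"
    unfolding g by (auto intro!: derivative_eq_intros)
  moreover have "g (x i) \<le> g y" for y
    using nonneg zero by (simp add: g_def)
  ultimately have "real k * link_form E x i - lam * (real k * x i ^ (k - 1)) = 0"
    by (intro DERIV_local_min[where d = 1]) auto
  then have "real k * (link_form E x i - lam * x i ^ (k - 1)) = 0"
    by (simp add: algebra_simps)
  then show ?thesis using k by simp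
qed

text \<open>For even \<open>k\<close> all summands of the norm are nonnegative, so the sphere lies
  in a cube and is compact.\<close>

lemma edge_form_attains_min:
  assumes k: "even k" "0 < k" and "V \<noteq> {}"
  obtains x where "(\<Sum>i\<in>V. x i ^ k) = 1"
    and "\<And>y. (\<Sum>i\<in>V. y i ^ k) = 1 \<Longrightarrow> edge_form E x \<le> (edge_form E y :: real)"
proof -
  \<comment> \<open>Vectors are functions on a possibly infinite type. Pinning the coordinates off
    \<open>V\<close> to 0 makes the cube compact by Tychonoff's theorem.\<close>
  define B :: "('a \<Rightarrow> real) set" where "B = PiE UNIV (\<lambda>i. if i \<in> V then {-1..1} else {0})"
  define K where "K = B \<inter> {x. (\<Sum>i\<in>V. x i ^ k) = 1}"
  have "compactin (product_topology (\<lambda>i. euclidean) UNIV) B"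
    unfolding B_def compactin_PiE by simp
  then have "compact B"
    by (simp add: euclidean_product_topology)
  moreover have "closed {x :: 'a \<Rightarrow> real. (\<Sum>i\<in>V. x i ^ k) = 1}"
    by (intro closed_Collect_eq continuous_intros continuous_on_product_coordinates)
  ultimately have "compact K"
    unfolding K_def by (rule compact_Int_closed)
  obtain v where v: "v \<in> V" using \<open>V \<noteq> {}\<close> by blast
  have "(\<Sum>i\<in>V. (if i = v then 1 else 0 :: real) ^ k) = (\<Sum>i\<in>V. if i = v then 1 else 0)"
    using k by (intro sum.cong) auto
  then have "(\<lambda>i. if i = v then 1 else 0) \<in> K"
    using v finite_vertices by (auto simp: K_def B_def)
  then have "K \<noteq> {}" by blast
  have "continuous_on K (\<lambda>x. edge_form E x)"
    unfolding edge_form_def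
    by (intro continuous_intros continuous_on_subset[OF continuous_on_product_coordinates]) auto
  from continuous_attains_inf[OF \<open>compact K\<close> \<open>K \<noteq> {}\<close> this]
  obtain x where x: "x \<in> K" "\<And>y. y \<in> K \<Longrightarrow> edge_form E x \<le> edge_form E y" by blast
  show thesis
  proof (rule that)
    show "(\<Sum>i\<in>V. x i ^ k) = 1" using x(1) by (simp add: K_def)
  next
    fix y :: "'a \<Rightarrow> real" assume y: "(\<Sum>i\<in>V. y i ^ k) = 1"
    \<comment> \<open>Truncation moves \<open>y\<close> into the cube and changes neither the norm
      nor the form.\<close>
    define z where "z i = (if i \<in> V then y i else 0)" for i
    have "\<bar>y i\<bar> \<le> 1" if "i \<in> V" for i
    proof -
      have "y i ^ k \<le> 1"
        unfolding y[symmetric] using k that finite_vertices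
        by (intro member_le_sum) (auto simp: zero_le_even_power)
      then have "\<bar>y i\<bar> ^ k \<le> 1" using k by (simp add: power_even_abs)
      then show ?thesis using k by (simp add: power_le_one_iff)
    qed
    then have "z \<in> B" by (auto simp: B_def z_def abs_le_iff minus_le_iff)
    then have "z \<in> K" using y by (simp add: K_def z_def)
    moreover have "edge_form E z = edge_form E y"
      unfolding edge_form_def z_def using edge_subset by (intro sum.cong prod.cong) auto
    ultimately show "edge_form E x \<le> edge_form E y" using x(2) by metis
  qed
qed

lemma edge_form_scale:
  "edge_form E (\<lambda>i. c * x i) = c ^ k * edge_form E (x :: 'a \<Rightarrow> 'b::comm_semiring_1)"
  unfolding edge_form_def sum_distrib_left
  by (intro sum.cong refl) (simp add: prod.distrib card_edge)

text \<open>\<open>k\<close> times the minimum on the sphere is the least H-eigenvalue, so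
  \<open>LEAST\<close> denotes a true minimum. Homogeneity carries nonnegativity from the sphere to
  all vectors, stationarity makes the minimiser an eigenvector, and the gap for another eigenvalue
  \<open>nu\<close> vanishes at its eigenvector, whence \<open>mu \<le> nu\<close>.\<close>

lemma min_H_eigenvalue_rayleigh_gap_nonneg:
  assumes k: "even k" "0 < k" and V: "V \<noteq> {}"
  shows "0 \<le> rayleigh_gap k V E (hypergraph_min_H_eigenvalue k V E) x"
proof -
  from edge_form_attains_min[OF k V] obtain x0 :: "'a \<Rightarrow> real"
    where x0: "(\<Sum>i\<in>V. x0 i ^ k) = 1"
      and min: "\<And>y. (\<Sum>i\<in>V. y i ^ k) = 1 \<Longrightarrow> edge_form E x0 \<le> edge_form E y" by blast
  define mu where "mu = real k * edge_form E x0"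
  have nonneg: "0 \<le> rayleigh_gap k V E mu y" for y
  proof (cases "\<forall>i\<in>V. y i = 0")
    case True
    have "(\<Prod>j\<in>e. y j) = 0" if e: "e \<in> E" for e
    proof -
      have "e \<noteq> {}" using card_edge[OF e] k by auto
      then show ?thesis using True edge_subset[OF e] finite_edge[OF e] by (auto simp: prod_zero_iff)
    qed
    then show ?thesis using True k by (simp add: rayleigh_gap_def edge_form_def power_0_left)
  next
    case False
    define N where "N = (\<Sum>i\<in>V. y i ^ k)"
    have "N > 0" unfolding N_def using False k finite_vertices
      by (auto intro!: sum_pos2 simp: zero_le_even_power zero_less_power_eq)
    define c where "c = 1 / root k N"
    have c: "c ^ k * N = 1"
      using \<open>N > 0\<close> k by (simp add: c_def power_divide)
    have "(\<Sum>i\<in>V. (c * y i) ^ k) = 1"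
      using c by (simp add: power_mult_distrib N_def sum_distrib_left)
    from min[OF this] have "edge_form E x0 \<le> c ^ k * edge_form E y"
      by (simp add: edge_form_scale)
    then have "N * edge_form E x0 \<le> N * (c ^ k * edge_form E y)"
      using \<open>N > 0\<close> by simp
    also have "\<dots> = (c ^ k * N) * edge_form E y" by (simp add: mult_ac)
    finally have "real k * (N * edge_form E x0) \<le> real k * edge_form E y"
      unfolding c by (intro mult_left_mono) auto
    then show ?thesis
      by (simp add: rayleigh_gap_def mu_def N_def mult_ac)
  qed
  have zero: "rayleigh_gap k V E mu x0 = 0"
    by (simp add: rayleigh_gap_def mu_def x0)
  have "\<exists>i\<in>V. x0 i \<noteq> 0"
  proof (rule ccontr)
    assume "\<not> ?thesis"
    then have "(\<Sum>i\<in>V. x0 i ^ k) = 0" using k by simp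
    with x0 show False by simp
  qed
  then have "H_eigenvalue V k (adjacency_tensor k E) mu"
    unfolding H_eigenvalue_iff[OF k(2)]
    using rayleigh_gap_minimizer_stationary[OF k(2) nonneg zero] by blast
  moreover have "mu \<le> nu" if "H_eigenvalue V k (adjacency_tensor k E) nu" for nu
  proof -
    from that obtain y where y: "\<exists>i\<in>V. y i \<noteq> 0" "\<forall>i\<in>V. link_form E y i = nu * y i ^ (k - 1)"
      unfolding H_eigenvalue_iff[OF k(2)] by blast
    have N: "(\<Sum>i\<in>V. y i ^ k) > 0" using y(1) k finite_vertices
      by (auto intro!: sum_pos2 simp: zero_le_even_power zero_less_power_eq)
    have "rayleigh_gap k V E nu y = 0"
      unfolding rayleigh_gap_euler[OF k(2)] using y(2) by simp
    with nonneg[of y] have "mu * (\<Sum>i\<in>V. y i ^ k) \<le> nu * (\<Sum>i\<in>V. y i ^ k)"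
      by (simp add: rayleigh_gap_def)
    with N show ?thesis by simp
  qed
  ultimately have "hypergraph_min_H_eigenvalue k V E = mu"
    unfolding hypergraph_min_H_eigenvalue_def min_H_eigenvalue_def by (rule Least_equality)
  then show ?thesis using nonneg by simp
qed

text \<open>The test vector lives on one edge \<open>e\<close> with a single sign flipped. Any other
  edge has the same size, so it leaves \<open>e\<close> and meets a zero coordinate; the form is
  -1.\<close>

lemma min_H_eigenvalue_neg:
  assumes k: "even k" "0 < k" and e: "e \<in> E"
  shows "hypergraph_min_H_eigenvalue k V E < 0"
proof -
  obtain v where v: "v \<in> e" using card_edge[OF e] k by fastforce
  define x where "x i = (if i = v then -1 else if i \<in> e then 1 else 0 :: real)" for i
  have fe: "finite e" and ev: "e \<subseteq> V" using e finite_edge edge_subset by auto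
  have "(\<Prod>j\<in>f. x j) = (if f = e then -1 else 0)" if f: "f \<in> E" for f
  proof (cases "f = e")
    case True
    then show ?thesis using v fe by (simp add: prod.remove[of e v] x_def)
  next
    case False
    then have "\<not> f \<subseteq> e" using card_subset_eq[OF fe] card_edge e f by metis
    then show ?thesis using False v finite_edge[OF f] by (auto simp: x_def prod_zero_iff)
  qed
  then have "edge_form E x = -1"
    using e finite_edges by (simp add: edge_form_def sum.delta)
  moreover have "V \<noteq> {}" using v ev by blast
  ultimately have "hypergraph_min_H_eigenvalue k V E * (\<Sum>i\<in>V. x i ^ k) \<le> - real k"
    using min_H_eigenvalue_rayleigh_gap_nonneg[OF k, of x] by (simp add: rayleigh_gap_def)
  moreover have "(\<Sum>i\<in>V. x i ^ k) \<ge> 0" using k by (intro sum_nonneg) (simp add: zero_le_even_power)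
  ultimately show ?thesis using k
    by (smt (verit) mult_nonneg_nonneg of_nat_0_less_iff)
qed


section \<open>Two-valued vectors on a t-independent set\<close>

text \<open>An edge meeting \<open>S\<close> contributes (-s)^t = -s^t, any other edge 1. The factor
  \<open>t\<close> appears because the degree sum over \<open>S\<close> counts each edge meeting
  \<open>S\<close> exactly \<open>t\<close> times.\<close>

lemma rayleigh_gap_two_valued:
  fixes s :: real
  assumes k: "even k" and t: "odd t" and S: "t_independent t V E S"
  shows "real t * rayleigh_gap k V E lam (\<lambda>i. if i \<in> S then - s else 1)
    = real t * (real k * real (card E) - real (card V) * lam)
      - real k * (\<Sum>i\<in>S. real (degree E i)) * (1 + s ^ t)
      - real t * lam * real (card S) * (s ^ k - 1)"
proof -
  let ?x = "\<lambda>i. if i \<in> S then - s else 1 :: real"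
  let ?ES = "{e \<in> E. e \<inter> S \<noteq> {}}"
  have SV: "S \<subseteq> V" and cap: "\<And>e. e \<in> ?ES \<Longrightarrow> card (e \<inter> S) = t"
    using S finite_edge by (auto simp: t_independent_def)
  have "(\<Sum>i\<in>S. real (degree E i)) = (\<Sum>e\<in>E. real (card (e \<inter> S)))"
    using sum_edges_at[OF SV, of "\<lambda>_. 1 :: real"] by (simp add: degree_def)
  also have "\<dots> = (\<Sum>e\<in>E. if e \<in> ?ES then real t else 0)"
    using cap by (intro sum.cong) auto
  also have "\<dots> = real t * card ?ES"
    using finite_edges by (simp add: sum.If_cases Int_def conj_commute)
  finally have deg: "(\<Sum>i\<in>S. real (degree E i)) = real t * card ?ES" .
  have "(\<Prod>j\<in>e. ?x j) = 1 - (if e \<in> ?ES then 1 + s ^ t else 0)" if e: "e \<in> E" for e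
  proof -
    have "(\<Prod>j\<in>e. ?x j) = (- s) ^ card (e \<inter> S)"
      using finite_edge[OF e] by (simp add: prod.If_cases Int_def)
    then show ?thesis using cap[of e] e t by auto
  qed
  then have "edge_form E ?x = (\<Sum>e\<in>E. 1 - (if e \<in> ?ES then 1 + s ^ t else 0))"
    by (simp add: edge_form_def)
  also have "\<dots> = real (card E) - real (card ?ES) * (1 + s ^ t)"
    using finite_edges by (simp add: sum_subtractf sum.If_cases Int_def conj_commute)
  finally have form: "edge_form E ?x = real (card E) - real (card ?ES) * (1 + s ^ t)" .
  have "(\<Sum>i\<in>V. ?x i ^ k) = (\<Sum>i\<in>V. 1 + (if i \<in> S then s ^ k - 1 else 0))"
    using k by (intro sum.cong) auto
  also have "\<dots> = real (card V) + real (card S) * (s ^ k - 1)"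
    using finite_vertices SV by (simp add: sum.distrib sum.If_cases Int_absorb1)
  finally have norm: "(\<Sum>i\<in>V. ?x i ^ k) = real (card V) + real (card S) * (s ^ k - 1)" .
  show ?thesis
    unfolding rayleigh_gap_def form norm deg by (simp add: algebra_simps)
qed

text \<open>Every edge at \<open>i\<close> meets \<open>S\<close>, and removing \<open>i\<close>
  leaves \<open>t - 1\<close> vertices of \<open>S\<close>, an even number, so the sign
  disappears.\<close>

lemma link_form_two_valued_inside:
  fixes s :: real
  assumes t: "odd t" and S: "t_independent t V E S" and i: "i \<in> S"
  shows "link_form E (\<lambda>i. if i \<in> S then - s else 1) i = real (degree E i) * s ^ (t - 1)"
proof -
  have "(\<Prod>j\<in>e - {i}. if j \<in> S then - s else 1) = s ^ (t - 1)" if e: "e \<in> edges_at E i" for e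
  proof -
    have e': "e \<in> E" "i \<in> e" "finite e" using e finite_edge by (auto simp: edges_at_def)
    then have "card (e \<inter> S) = t" using S i by (auto simp: t_independent_def card_eq_0_iff)
    moreover have "(e - {i}) \<inter> S = e \<inter> S - {i}" by blast
    ultimately have "card ((e - {i}) \<inter> S) = t - 1"
      using e' i by simp
    moreover have "(\<Prod>j\<in>e - {i}. if j \<in> S then - s else 1) = (- s) ^ card ((e - {i}) \<inter> S)"
      using e' by (simp add: prod.If_cases Int_def)
    ultimately show ?thesis using t by simp
  qed
  then show ?thesis by (simp add: link_form_def degree_def)
qed

lemma link_form_two_valued_outside:
  fixes s :: real
  assumes t: "odd t" and S: "t_independent t V E S" and i: "i \<notin> S"
  shows "link_form E (\<lambda>i. if i \<in> S then - s else 1) i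
    = real (degree E i) - real (card {e \<in> edges_at E i. e \<inter> S \<noteq> {}}) * (1 + s ^ t)"
proof -
  let ?ES = "{e. e \<inter> S \<noteq> {}}"
  have fin: "finite (edges_at E i)" using finite_edges by (simp add: edges_at_def)
  have "(\<Prod>j\<in>e - {i}. if j \<in> S then - s else 1) = 1 - (if e \<in> ?ES then 1 + s ^ t else 0)"
    if e: "e \<in> edges_at E i" for e
  proof -
    have e': "e \<in> E" "finite e" using e finite_edge by (auto simp: edges_at_def)
    have "(e - {i}) \<inter> S = e \<inter> S" using i by blast
    moreover have "(\<Prod>j\<in>e - {i}. if j \<in> S then - s else 1) = (- s) ^ card ((e - {i}) \<inter> S)"
      using e' by (simp add: prod.If_cases Int_def)
    moreover have "card (e \<inter> S) = (if e \<in> ?ES then t else 0)"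
      using S e' by (auto simp: t_independent_def card_eq_0_iff)
    ultimately show ?thesis using t by auto
  qed
  then have "link_form E (\<lambda>i. if i \<in> S then - s else 1) i
      = (\<Sum>e\<in>edges_at E i. 1 - (if e \<in> ?ES then 1 + s ^ t else 0))"
    by (simp add: link_form_def)
  also have "\<dots> = real (degree E i) - real (card {e \<in> edges_at E i. e \<inter> S \<noteq> {}}) * (1 + s ^ t)"
    using fin by (simp add: sum_subtractf sum.If_cases Int_def degree_def)
  finally show ?thesis .
qed

lemma min_degree_le: "i \<in> V \<Longrightarrow> min_degree V E \<le> degree E i"
  using finite_vertices by (simp add: min_degree_def)

section \<open>The bound for a single t-independent set\<close>

lemma t_independent_card_bound:
  fixes t :: nat
  defines "lam \<equiv> hypergraph_min_H_eigenvalue k V E"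
    and "\<delta> \<equiv> min_degree V E"
    and "p \<equiv> real t / (real k - real t)"
    and "q \<equiv> real k / (real k - real t)"
  defines "bound \<equiv> (real t * (real k * real (card E) - real (card V) * lam) * (- lam) powr p) /
                     ((real k - real t) * real \<delta> powr q
                       + (real k * real \<delta> - real t * lam) * (- lam) powr p)"
  assumes k: "even k" and t: "odd t" "t < k" and E: "E \<noteq> {}"
    and S: "t_independent t V E S"
  shows "real (card S) \<le> bound"
    and "real (card S) = bound \<longleftrightarrow>
      (\<forall>i\<in>S. degree E i = \<delta>) \<and>
      (\<forall>i\<in>V - S. real (card {e \<in> edges_at E i. e \<inter> S \<noteq> {}})
        = ((- lam) powr q + real (degree E i) * (- lam) powr p) / (real \<delta> powr p + (- lam) powr p))"
proof -
  have t0: "0 < t" using t(1) by (rule odd_pos)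
  with t(2) have k0: "0 < k" by simp
  obtain e where e: "e \<in> E" using E by blast
  have V: "V \<noteq> {}" using edge_subset[OF e] card_edge[OF e] k0 by auto
  have SV: "S \<subseteq> V" using S by (simp add: t_independent_def)
  then have fS: "finite S" using finite_vertices finite_subset by blast
  have lam: "lam < 0" unfolding lam_def by (rule min_H_eigenvalue_neg[OF k k0 e])
  have nonneg: "0 \<le> rayleigh_gap k V E lam x" for x
    unfolding lam_def by (rule min_H_eigenvalue_rayleigh_gap_nonneg[OF k k0 V])
  define W where "W = (- lam) powr p"
  have W: "W > 0" using lam by (simp add: W_def)
  \<comment> \<open>With exponents one apart, all powers reduce to \<open>W\<close> and
    \<open>\<delta> powr p\<close>.\<close>
  have q: "q = 1 + p" using t by (simp add: p_def q_def field_simps)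
  have Wq: "(- lam) powr q = - lam * W"
    using lam by (simp add: q powr_add W_def)
  (* s maximises k \<delta> (1 + s^t) + t lam (s^k - 1) over s \<ge> 0, which gives the sharpest bound on card S. *)
  define s where "s = (real \<delta> / (- lam)) powr (1 / (real k - real t))"
  have s0: "0 \<le> s" by (simp add: s_def)
  \<comment> \<open>\<open>0 < j\<close> is essential when \<open>\<delta> = 0\<close>: then
    \<open>s ^ 0 = 1\<close>, whereas \<open>0 powr 0 = 0\<close>.\<close>
  have s_pow: "s ^ j = (real \<delta> / (- lam)) powr (real j / (real k - real t))" if "0 < j" for j
    using that lam by (cases "\<delta> = 0") (simp_all add: s_def powr_power)
  have ratio: "(real \<delta> / (- lam)) powr a = real \<delta> powr a / (- lam) powr a" for a
    by (rule powr_divide)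
  have st: "s ^ t = real \<delta> powr p / W"
    by (simp only: s_pow[OF t0] ratio p_def W_def)
  have "s ^ k = real \<delta> powr q / (- lam * W)"
    by (simp only: s_pow[OF k0] ratio q_def flip: Wq)
  then have sk: "lam * W * s ^ k = - (real \<delta> powr q)"
    using lam W by simp
  have skt: "s ^ (k - t) = real \<delta> / (- lam)"
    using s_pow[of "k - t"] t lam by (simp add: of_nat_diff powr_one)
  define x where "x = (\<lambda>i. if i \<in> S then - s else 1)"
  define c where "c i = card {e \<in> edges_at E i. e \<inter> S \<noteq> {}}" for i
  define D where "D = (real k - real t) * real \<delta> powr q + (real k * real \<delta> - real t * lam) * W"
  have "D > 0"
  proof -
    have "real t * lam < 0" using t0 lam by (simp add: mult_pos_neg)
    then have "real k * real \<delta> - real t * lam > 0" by (simp add: less_le_trans)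
    then have "(real k * real \<delta> - real t * lam) * W > 0" using W by (rule mult_pos_pos)
    then show ?thesis using t by (simp add: D_def add_nonneg_pos)
  qed
  have dq: "real \<delta> powr q = real \<delta> * real \<delta> powr p"
    by (cases "\<delta> = 0") (auto simp: q powr_add)
  define excess where "excess = (\<Sum>i\<in>S. real (degree E i) - real \<delta>)"
  have deg_sum: "(\<Sum>i\<in>S. real (degree E i)) = excess + real \<delta> * real (card S)"
    by (simp add: excess_def sum_subtractf)
  have degree_ge: "\<And>i. i \<in> S \<Longrightarrow> 0 \<le> real (degree E i) - real \<delta>"
    using min_degree_le SV by (auto simp: \<delta>_def)
  then have excess: "0 \<le> excess" "excess = 0 \<longleftrightarrow> (\<forall>i\<in>S. degree E i = \<delta>)"
    using fS by (auto simp: excess_def sum_nonneg sum_nonneg_eq_0_iff)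
  \<comment> \<open>Multiplying by \<open>W\<close> clears the denominators of \<open>s ^ t\<close>
    and \<open>s ^ k\<close>; the coefficient of \<open>card S\<close> then collects to
    \<open>- D\<close>.\<close>
  have "real t * W * rayleigh_gap k V E lam x = W * (real t * rayleigh_gap k V E lam x)"
    by (simp only: mult_ac)
  also have "\<dots> = W * (real t * (real k * real (card E) - real (card V) * lam)
      - real k * (excess + real \<delta> * real (card S)) * (1 + s ^ t)
      - real t * lam * real (card S) * (s ^ k - 1))"
    unfolding x_def rayleigh_gap_two_valued[OF k t(1) S] deg_sum ..
  also have "\<dots> = real t * (real k * real (card E) - real (card V) * lam) * W
      - real k * excess * (1 + s ^ t) * W - real k * real \<delta> * real (card S) * (W + W * s ^ t)
      - real t * real (card S) * (lam * W * s ^ k) + real t * lam * real (card S) * W"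
    by (simp add: algebra_simps)
  also have "W * s ^ t = real \<delta> powr p" using W by (simp add: st)
  also have "real t * (real k * real (card E) - real (card V) * lam) * W
      - real k * excess * (1 + s ^ t) * W - real k * real \<delta> * real (card S) * (W + real \<delta> powr p)
      - real t * real (card S) * (lam * W * s ^ k) + real t * lam * real (card S) * W
      = (bound - real (card S)) * D - real k * excess * (1 + s ^ t) * W"
  proof -
    have "bound * D = real t * (real k * real (card E) - real (card V) * lam) * W"
      using \<open>D > 0\<close> by (simp add: bound_def D_def W_def)
    then have "(bound - real (card S)) * D
        = real t * (real k * real (card E) - real (card V) * lam) * W - real (card S) * D"
      by (simp add: left_diff_distrib)
    then show ?thesis unfolding sk D_def dq by (simp add: algebra_simps)
  qed
  finally have key: "(bound - real (card S)) * D
      = real t * W * rayleigh_gap k V E lam x + real k * (1 + s ^ t) * W * excess"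
    by simp
  have pos: "0 < real t * W" "0 < real k * (1 + s ^ t) * W"
    using t0 k0 W s0 by (auto simp: add_pos_nonneg)
  have summands: "0 \<le> real t * W * rayleigh_gap k V E lam x" "0 \<le> real k * (1 + s ^ t) * W * excess"
    using pos nonneg[of x] excess(1) by (simp_all only: mult_nonneg_nonneg less_imp_le)
  show "real (card S) \<le> bound"
    using key summands \<open>D > 0\<close> by (smt (verit) mult_neg_pos)
  have "real (card S) = bound \<longleftrightarrow> (bound - real (card S)) * D = 0"
    using \<open>D > 0\<close> by auto
  also have "\<dots> \<longleftrightarrow> real t * W * rayleigh_gap k V E lam x = 0 \<and> real k * (1 + s ^ t) * W * excess = 0"
    unfolding key using summands by (rule add_nonneg_eq_0_iff)
  also have "\<dots> \<longleftrightarrow> excess = 0 \<and> rayleigh_gap k V E lam x = 0"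
    using pos by auto
  also have "\<dots> \<longleftrightarrow> (\<forall>i\<in>S. degree E i = \<delta>) \<and> (\<forall>i\<in>V - S. link_form E x i = lam)"
  proof (unfold excess(2), intro conj_cong refl)
    assume deg: "\<forall>i\<in>S. degree E i = \<delta>"
    have outside: "x i = 1" if "i \<in> V - S" for i using that by (simp add: x_def)
    have inside: "link_form E x i - lam * x i ^ (k - 1) = 0" if "i \<in> S" for i
    proof -
      \<comment> \<open>The factor \<open>s ^ (k - t)\<close> cancels \<open>lam\<close>, and the
        remaining \<open>s ^ (t - 1)\<close> matches the link form, also for
        \<open>t = 1\<close>.\<close>
      have "k - 1 = (k - t) + (t - 1)" using t t0 by simp
      then have "s ^ (k - 1) = real \<delta> / (- lam) * s ^ (t - 1)"
        by (simp only: power_add skt)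
      moreover have "odd (k - 1)" using k k0 by simp
      then have "x i ^ (k - 1) = - (s ^ (k - 1))" using that by (simp add: x_def)
      moreover have "link_form E x i = real \<delta> * s ^ (t - 1)"
        using link_form_two_valued_inside[OF t(1) S that] deg that by (simp add: x_def)
      ultimately show ?thesis using lam by simp
    qed
    \<comment> \<open>Forwards, a zero of the gap is stationary. Backwards, all residuals vanish,
      and Euler's identity makes the gap zero.\<close>
    show "rayleigh_gap k V E lam x = 0 \<longleftrightarrow> (\<forall>i\<in>V - S. link_form E x i = lam)"
    proof
      assume "rayleigh_gap k V E lam x = 0"
      from rayleigh_gap_minimizer_stationary[OF k0 nonneg this]
      show "\<forall>i\<in>V - S. link_form E x i = lam" using outside by auto
    next
      assume "\<forall>i\<in>V - S. link_form E x i = lam"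
      then have "link_form E x i - lam * x i ^ (k - 1) = 0" if "i \<in> V" for i
        using inside outside that by (cases "i \<in> S") auto
      then show "rayleigh_gap k V E lam x = 0"
        unfolding rayleigh_gap_euler[OF k0] by (intro sum.neutral) simp
    qed
  qed
  also have "\<dots> \<longleftrightarrow> (\<forall>i\<in>S. degree E i = \<delta>) \<and>
      (\<forall>i\<in>V - S. real (c i)
        = ((- lam) powr q + real (degree E i) * (- lam) powr p) / (real \<delta> powr p + (- lam) powr p))"
  proof (intro conj_cong ball_cong refl)
    fix i assume "i \<in> V - S"
    then have "link_form E x i = real (degree E i) - real (c i) * (1 + s ^ t)"
      unfolding x_def c_def by (intro link_form_two_valued_outside[OF t(1) S]) simp
    then have "link_form E x i = lam \<longleftrightarrow> real (degree E i) - real (c i) * (1 + s ^ t) = lam"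
      by simp
    \<comment> \<open>Multiply by \<open>W\<close>, using that (1 + s^t) W is
      \<open>\<delta> powr p + W\<close>.\<close>
    also have "\<dots> \<longleftrightarrow> real (degree E i) * W - real (c i) * (real \<delta> powr p + W) = lam * W"
      unfolding st using W by (simp add: field_simps)
    also have "\<dots> \<longleftrightarrow> real (c i) * (real \<delta> powr p + W) = - lam * W + real (degree E i) * W"
      by auto
    also have "\<dots> \<longleftrightarrow> real (c i) = (- lam * W + real (degree E i) * W) / (real \<delta> powr p + W)"
    proof -
      have "real \<delta> powr p + W \<noteq> 0" using W by (smt (verit) powr_ge_zero)
      then show ?thesis by (simp only: eq_divide_eq if_True not_False_eq_True)
    qed
    finally show "link_form E x i = lam \<longleftrightarrow> real (c i)
        = ((- lam) powr q + real (degree E i) * (- lam) powr p) / (real \<delta> powr p + (- lam) powr p)"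
      unfolding Wq W_def[symmetric] .
  qed
  finally show "real (card S) = bound \<longleftrightarrow>
      (\<forall>i\<in>S. degree E i = \<delta>) \<and>
      (\<forall>i\<in>V - S. real (card {e \<in> edges_at E i. e \<inter> S \<noteq> {}})
        = ((- lam) powr q + real (degree E i) * (- lam) powr p) / (real \<delta> powr p + (- lam) powr p))"
    unfolding c_def .
qed

section \<open>Passage to the t-independence number\<close>

lemma finite_t_independent: "finite {S. t_independent t V E S}"
  by (rule finite_subset[of _ "Pow V"]) (auto simp: t_independent_def finite_vertices)

lemma card_le_t_independence_number:
  "t_independent t V E S \<Longrightarrow> card S \<le> t_independence_number t V E"
  by (simp add: t_independence_number_def finite_t_independent)

lemma t_independence_number_attained:
  obtains S where "t_independent t V E S" "card S = t_independence_number t V E"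
proof -
  have "t_independent t V E {}" by (simp add: t_independent_def)
  then have "card ` {S. t_independent t V E S} \<noteq> {}" by blast
  from Max_in[OF _ this] show ?thesis
    using that finite_t_independent by (auto simp: t_independence_number_def)
qed

text \<open>A set satisfying \<open>P\<close> has size \<open>b\<close>, the upper bound, so it is a
  maximum set; conversely, a maximum set of size \<open>b\<close> satisfies
  \<open>P\<close>.\<close>

lemma t_independence_number_le_and_eq_iff:
  fixes b :: real
  assumes le: "\<And>S. t_independent t V E S \<Longrightarrow> real (card S) \<le> b"
    and eq: "\<And>S. t_independent t V E S \<Longrightarrow> real (card S) = b \<longleftrightarrow> P S"
  shows "real (t_independence_number t V E) \<le> b \<and>
    (real (t_independence_number t V E) = b \<longleftrightarrow> (\<exists>S. t_independent t V E S \<and> P S))"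
proof -
  obtain S where S: "t_independent t V E S" "card S = t_independence_number t V E"
    by (rule t_independence_number_attained)
  have "real (t_independence_number t V E) \<le> b"
    using le[OF S(1)] S(2) by simp
  moreover have "real (t_independence_number t V E) = b" if "t_independent t V E T" "P T" for T
    using calculation card_le_t_independence_number[OF that(1)] eq[OF that(1)] that(2) by linarith
  ultimately show ?thesis
    using eq[OF S(1)] S by metis
qed

end

theorem theorem3p1:
  fixes V :: "'a set" and E :: "'a set set"
    and k t n m \<delta> :: nat and lam :: real
  assumes "even k" and "odd t" and "0 < t" and "t < k"
    and "uniform_hypergraph k V E"
    and "n = card V" and "m = card E" and "m \<ge> 1"
    and "\<delta> = min_degree V E"
    and "lam = hypergraph_min_H_eigenvalue k V E"
  shows "let p = real t / (real k - real t);
             q = real k / (real k - real t);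
             bound = (real t * (real k * real m - real n * lam) * (- lam) powr p) /
                     ((real k - real t) * real \<delta> powr q
                       + (real k * real \<delta> - real t * lam) * (- lam) powr p)
         in real (t_independence_number t V E) \<le> bound \<and>
            (real (t_independence_number t V E) = bound \<longleftrightarrow>
              (\<exists>S. t_independent t V E S \<and>
                   (\<forall>i\<in>S. degree E i = \<delta>) \<and>
                   (\<forall>i\<in>V - S.
                      real (card {e \<in> edges_at E i. e \<inter> S \<noteq> {}})
                      = ((- lam) powr q + real (degree E i) * (- lam) powr p)
                        / (real \<delta> powr p + (- lam) powr p))))"
proof -
  have E: "E \<noteq> {}" using assms(7,8) by auto
  note bound = t_independent_card_bound[OF assms(5,1,2,4) E, folded assms(6,7,9,10)]
  show ?thesis
    unfolding Let_def by (rule t_independence_number_le_and_eq_iff[OF assms(5) bound])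
qed

end
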